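(* Let $C_n$ be a metric cycle with vertices $V=\{v_1,v_2,\dots,v_n\}$ and let $\mathscr{D}=\{D_v : v\in V\}$ be a KKM cover of the cycle $C_n$. Then there is a point $x$ in $C_n$ such that $x$ is in at least $\lfloor \frac{n}{2}\rfloor+1$ sets of $\mathscr{D}$, i.e. $|\{v\in V : x\in D_v\}|\ge \lfloor \frac{n}{2}\rfloor+1$.
   Context: A cycle is a finite graph with vertices $v_1,\dots,v_n$ and edges $(v_i,v_{i+1})$ for $1\le i<n$ as well as $(v_n,v_1)$. A metric cycle is a triple $(V,E,X)$ where $(V,E)$ is a cycle and $X$ is the metric space obtained by realizing every edge $e$ as an isometric copy of a closed interval $[0,L_e]$ with $L_e>0$ and gluing these intervals at their endpoints according to $(V,E)$. Topologically $X$ is a circle, partitioned into finitely many segments joined at the points $v_1,\dots,v_n$. Between any two distinct points there are exactly two paths (arcs), and the distance is the minimum of the lengths of the two paths. A point of $C_n$ means a point of $X$. A KKM cover of the cycle $C_n$ is a family, indexed by $V$, of closed sets $\mathscr{D}=\{D_v : v\in V\}$ (closed subsets of $X$) such that: (i) $v\in D_v$ for each $v\in V$; and (ii) for all $v,w\in V$, at least one of the paths between $v$ and $w$ in $C_n$ is contained in $D_v\cup D_w$. Sets of the family are counted by index. *)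

theory Defs
  imports "HOL-Analysis.Analysis"
begin

text \<open>
  The vertices are \<open>0, \<dots>, n - 1\<close>; edge \<open>e < n\<close> joins \<open>e\<close> to \<open>Suc e mod n\<close> and has length \<open>L e\<close>.
  For \<open>n = 1\<close> and \<open>n = 2\<close> this is a loop and a double edge, so that the realization is always a circle.
\<close>

locale metric_cycle =
  fixes n :: nat and L :: "nat \<Rightarrow> real"
  assumes n_pos: "1 \<le> n"
    and L_pos: "e < n \<Longrightarrow> 0 < L e"
begin

text \<open>Disjoint union of the intervals \<open>[0, L e]\<close>: the pair \<open>(e, t)\<close> is the point of edge \<open>e\<close> at distance
  \<open>t\<close> from its initial endpoint \<open>e\<close>.\<close>

definition edge_union :: "(nat \<times> real) set" where
  "edge_union = (SIGMA e:{..<n}. {0..L e})"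

text \<open>The interval endpoints that are glued to each other at \<open>v\<close>. As an equivalence class, this set is
  itself the point of the glued space that realizes \<open>v\<close>.\<close>

definition vertex :: "nat \<Rightarrow> (nat \<times> real) set" where
  "vertex v = {(v, 0)} \<union> {(e, L e) |e. e < n \<and> Suc e mod n = v}"

definition glue :: "((nat \<times> real) \<times> (nat \<times> real)) set" where
  "glue = Id_on edge_union \<union> (\<Union>v<n. vertex v \<times> vertex v)"

definition points :: "(nat \<times> real) set set" where
  "points = edge_union // glue"

definition total_length :: real where
  "total_length = (\<Sum>e<n. L e)"

text \<open>Distance travelled from vertex \<open>0\<close> in the direction \<open>0, 1, \<dots>, n - 1\<close>. The vertex \<open>0\<close> itself is
  met at travelled distance \<open>0\<close> and again at \<open>total_length\<close>; the minimum selects \<open>0\<close>.\<close>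

definition pos :: "(nat \<times> real) set \<Rightarrow> real" where
  "pos x = Min ((\<lambda>(e, t). (\<Sum>j<e. L j) + t) ` x)"

text \<open>Travelling from \<open>x\<close> in the direction \<open>0, 1, \<dots>, n - 1\<close> until \<open>y\<close> is first met: the length of this
  path and the set of its points. The two paths between \<open>x \<noteq> y\<close> are \<open>path_from x y\<close> and \<open>path_from y x\<close>;
  for \<open>x = y\<close> both are the constant path.\<close>

definition travel :: "(nat \<times> real) set \<Rightarrow> (nat \<times> real) set \<Rightarrow> real" where
  "travel x y = (if pos x \<le> pos y then pos y - pos x else total_length - (pos x - pos y))"

definition path_from :: "(nat \<times> real) set \<Rightarrow> (nat \<times> real) set \<Rightarrow> (nat \<times> real) set set" where
  "path_from x y = {z \<in> points. travel x z \<le> travel x y}"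

text \<open>The value outside \<open>points\<close> is irrelevant; \<open>0\<close> is chosen because \<open>Metric_space\<close> requires
  nonnegativity on the whole type.\<close>

definition cdist :: "(nat \<times> real) set \<Rightarrow> (nat \<times> real) set \<Rightarrow> real" where
  "cdist x y = (if x \<in> points \<and> y \<in> points then min (travel x y) (travel y x) else 0)"

definition kkm_cover :: "(nat \<Rightarrow> (nat \<times> real) set set) \<Rightarrow> bool" where
  "kkm_cover D \<longleftrightarrow>
     (\<forall>v<n. closedin (Metric_space.mtopology points cdist) (D v)) \<and>
     (\<forall>v<n. vertex v \<in> D v) \<and>
     (\<forall>v<n. \<forall>w<n. path_from (vertex v) (vertex w) \<subseteq> D v \<union> D w \<or>
                  path_from (vertex w) (vertex v) \<subseteq> D v \<union> D w)"


subsection \<open>The glued space is a metric space\<close>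

lemma vertex_subset: "v < n \<Longrightarrow> vertex v \<subseteq> edge_union"
  using L_pos by (auto simp: vertex_def edge_union_def less_imp_le)

lemma vertex_disjoint:
  assumes "v < n" "w < n" "p \<in> vertex v" "p \<in> vertex w"
  shows "v = w"
  using assms L_pos by (force simp: vertex_def)

lemma equiv_glue: "equiv edge_union glue"
proof (rule equivI)
  show "glue \<subseteq> edge_union \<times> edge_union"
    using vertex_subset by (fastforce simp: glue_def)
  show "refl_on edge_union glue"
    using vertex_subset by (fastforce simp: glue_def refl_on_def)
  show "sym glue"
    by (auto simp: glue_def sym_def)
  show "trans glue"
    using vertex_disjoint by (fastforce simp: glue_def trans_def)
qed

lemma glue_Image_vertex: "v < n \<Longrightarrow> p \<in> vertex v \<Longrightarrow> glue `` {p} = vertex v"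
  using vertex_disjoint vertex_subset by (fastforce simp: glue_def)

lemma vertex_in_points: "v < n \<Longrightarrow> vertex v \<in> points"
proof -
  assume v: "v < n"
  have m: "(v, 0) \<in> vertex v" by (simp add: vertex_def)
  then have "glue `` {(v, 0)} \<in> edge_union // glue"
    using vertex_subset[OF v] by (intro quotientI) auto
  then show ?thesis using glue_Image_vertex[OF v m] by (simp add: points_def)
qed

lemma glue_Image_inner:
  assumes "p \<in> edge_union" "\<And>v. v < n \<Longrightarrow> p \<notin> vertex v"
  shows "glue `` {p} = {p}"
  using assms by (auto simp: glue_def)

lemma points_cases:
  assumes "x \<in> points"
  obtains (vertex) v where "v < n" "x = vertex v"
    | (inner) e t where "e < n" "0 < t" "t < L e" "x = {(e, t)}"
proof -
  obtain e t where p: "(e, t) \<in> edge_union" "x = glue `` {(e, t)}"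
    using assms by (auto simp: points_def elim!: quotientE)
  then have e: "e < n" "0 \<le> t" "t \<le> L e" by (auto simp: edge_union_def)
  show thesis
  proof (cases "\<exists>v<n. (e, t) \<in> vertex v")
    case True
    then show ?thesis using p glue_Image_vertex that(1) by metis
  next
    case False
    have "t \<noteq> 0" using False e by (auto simp: vertex_def)
    moreover have "t \<noteq> L e"
    proof
      assume "t = L e"
      then have "(e, t) \<in> vertex (Suc e mod n)" using e by (auto simp: vertex_def)
      then show False using False n_pos by auto
    qed
    moreover have "x = {(e, t)}" using glue_Image_inner[OF p(1)] p(2) False by auto
    ultimately show ?thesis using that(2) e by force
  qed
qed

lemma pos_inner: "pos {(e, t)} = (\<Sum>j<e. L j) + t"
  by (simp add: pos_def)

lemma sum_L_mono: "d \<le> e \<Longrightarrow> e \<le> n \<Longrightarrow> (\<Sum>j<d. L j) \<le> (\<Sum>j<e. L j)"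
  using L_pos by (intro sum_mono2) (auto intro!: less_imp_le)

lemma finite_vertex: "finite (vertex v)"
  by (auto simp: vertex_def intro: finite_subset[of _ "(\<lambda>e. (e, L e)) ` {..<n}"])

lemma pos_vertex:
  assumes "v < n"
  shows "pos (vertex v) = (\<Sum>j<v. L j)"
  unfolding pos_def
proof (rule Min_eqI)
  show "(\<Sum>j<v. L j) \<in> (\<lambda>(e, t). (\<Sum>j<e. L j) + t) ` vertex v"
    by (force simp: vertex_def)
  fix y assume "y \<in> (\<lambda>(e, t). (\<Sum>j<e. L j) + t) ` vertex v"
  then consider "y = (\<Sum>j<v. L j)" | e where "e < n" "Suc e mod n = v" "y = (\<Sum>j<Suc e. L j)"
    by (auto simp: vertex_def)
  then show "(\<Sum>j<v. L j) \<le> y"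
  proof cases
    case 2
    have "v \<le> Suc e" using 2 by auto
    then show ?thesis using sum_L_mono[of v "Suc e"] 2 by auto
  qed auto
qed (use finite_vertex in auto)

lemma points_rep:
  assumes "x \<in> points"
  obtains e t where "e < n" "0 \<le> t" "t < L e" "pos x = (\<Sum>j<e. L j) + t"
    "x = (if t = 0 then vertex e else {(e, t)})"
  using assms
proof (cases rule: points_cases)
  case (vertex v)
  then show ?thesis using that[of v 0] L_pos by (simp add: pos_vertex)
next
  case (inner e t)
  then show ?thesis using that[of e t] by (simp add: pos_inner)
qed

lemma pos_bounds:
  assumes "x \<in> points"
  shows "0 \<le> pos x" "pos x < total_length"
proof -
  obtain e t where e: "e < n" "0 \<le> t" "t < L e" "pos x = (\<Sum>j<e. L j) + t"
    using points_rep[OF assms] by metis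
  have "(\<Sum>j<Suc e. L j) \<le> total_length"
    unfolding total_length_def using e by (intro sum_L_mono) auto
  then show "pos x < total_length" using e by simp
  show "0 \<le> pos x" using sum_L_mono[of 0 e] e by simp
qed

lemma pos_inject:
  assumes "x \<in> points" "y \<in> points" "pos x = pos y"
  shows "x = y"
proof -
  obtain e t where e: "e < n" "0 \<le> t" "t < L e" "pos x = (\<Sum>j<e. L j) + t"
    "x = (if t = 0 then vertex e else {(e, t)})"
    using points_rep[OF assms(1)] by metis
  obtain d s where d: "d < n" "0 \<le> s" "s < L d" "pos y = (\<Sum>j<d. L j) + s"
    "y = (if s = 0 then vertex d else {(d, s)})"
    using points_rep[OF assms(2)] by metis
  have "\<not> e < d" using sum_L_mono[of "Suc e" d] e d assms(3) by auto
  moreover have "\<not> d < e" using sum_L_mono[of "Suc d" e] e d assms(3) by auto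
  ultimately have "e = d" by simp
  then show ?thesis using e d assms(3) by simp
qed

lemma pos_eq_iff: "x \<in> points \<Longrightarrow> y \<in> points \<Longrightarrow> pos x = pos y \<longleftrightarrow> x = y"
  using pos_inject by blast

lemma pos_image: "pos ` points = {0..<total_length}"
proof
  show "pos ` points \<subseteq> {0..<total_length}" using pos_bounds by auto
  show "{0..<total_length} \<subseteq> pos ` points"
  proof
    fix s assume s: "s \<in> {0..<total_length}"
    define e where "e = (LEAST k. s < (\<Sum>j<Suc k. L j))"
    have ex: "s < (\<Sum>j<Suc (n - 1). L j)" using s n_pos by (simp add: total_length_def)
    have e1: "s < (\<Sum>j<Suc e. L j)" unfolding e_def by (rule LeastI[where P = "\<lambda>k. s < (\<Sum>j<Suc k. L j)", OF ex])
    have "e \<le> n - 1" unfolding e_def by (rule Least_le[where P = "\<lambda>k. s < (\<Sum>j<Suc k. L j)", OF ex])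
    then have en: "e < n" using n_pos by simp
    have e2: "(\<Sum>j<e. L j) \<le> s"
    proof (cases e)
      case (Suc k)
      then have "\<not> s < (\<Sum>j<Suc k. L j)" unfolding e_def by (intro not_less_Least) simp
      then show ?thesis using Suc by simp
    qed (use s in simp)
    show "s \<in> pos ` points"
    proof (cases "s = (\<Sum>j<e. L j)")
      case True
      then show ?thesis using pos_vertex[OF en] vertex_in_points[OF en] by force
    next
      case False
      define t where "t = s - (\<Sum>j<e. L j)"
      have t: "0 < t" "t < L e" using False e1 e2 by (auto simp: t_def)
      have "glue `` {(e, t)} = {(e, t)}"
        using en t by (intro glue_Image_inner) (auto simp: edge_union_def vertex_def)
      then have "{(e, t)} \<in> points"
        using quotientI[of "(e, t)" edge_union glue] en t by (auto simp: points_def edge_union_def)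
      then show ?thesis by (force simp: pos_inner t_def)
    qed
  qed
qed

lemma travel_sum:
  "x \<in> points \<Longrightarrow> y \<in> points \<Longrightarrow> x \<noteq> y \<Longrightarrow> travel x y + travel y x = total_length"
  using pos_inject[of x y] by (auto simp: travel_def)

lemma cdist_eq:
  assumes "x \<in> points" "y \<in> points"
  shows "cdist x y = min \<bar>pos x - pos y\<bar> (total_length - \<bar>pos x - pos y\<bar>)"
  using assms pos_bounds[OF assms(1)] pos_bounds[OF assms(2)] by (auto simp: cdist_def travel_def)

lemma Metric_space_cdist: "Metric_space points cdist"
proof
  fix x y
  show "0 \<le> cdist x y"
    using pos_bounds[of x] pos_bounds[of y] by (auto simp: cdist_def travel_def)
  show "cdist x y = cdist y x" by (auto simp: cdist_def)
next
  fix x y assume xy: "x \<in> points" "y \<in> points"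
  show "cdist x y = 0 \<longleftrightarrow> x = y"
    using pos_bounds[OF xy(1)] pos_bounds[OF xy(2)] pos_eq_iff[OF xy] xy
    by (auto simp: cdist_def travel_def min_def)
next
  fix x y z assume xyz: "x \<in> points" "y \<in> points" "z \<in> points"
  show "cdist x z \<le> cdist x y + cdist y z"
    using pos_bounds[OF xyz(1)] pos_bounds[OF xyz(2)] pos_bounds[OF xyz(3)]
    unfolding cdist_eq[OF xyz(1,3)] cdist_eq[OF xyz(1,2)] cdist_eq[OF xyz(2,3)] by linarith
qed

sublocale Metric_space points cdist
  by (rule Metric_space_cdist)


subsection \<open>The two paths between two points\<close>

lemma path_from_Un:
  assumes "x \<in> points" "y \<in> points" "x \<noteq> y"
  shows "path_from x y \<union> path_from y x = points"
proof -
  have "travel x z \<le> travel x y \<or> travel y z \<le> travel y x" if z: "z \<in> points" for z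
    using pos_bounds[OF z] pos_bounds[OF assms(1)] pos_bounds[OF assms(2)] pos_eq_iff[OF assms(1,2)] assms(3)
    by (auto simp: travel_def)
  then show ?thesis by (auto simp: path_from_def)
qed

lemma path_from_Int:
  assumes "x \<in> points" "y \<in> points" "x \<noteq> y"
  shows "path_from x y \<inter> path_from y x = {x, y}"
proof -
  have "z = x \<or> z = y" if z: "z \<in> points" "travel x z \<le> travel x y" "travel y z \<le> travel y x" for z
  proof -
    have "pos x \<noteq> pos y" using pos_eq_iff[OF assms(1,2)] assms(3) by simp
    then have "pos z = pos x \<or> pos z = pos y"
      using z(2,3) pos_bounds[OF z(1)] pos_bounds[OF assms(1)] pos_bounds[OF assms(2)]
      unfolding travel_def by argo
    then show ?thesis using pos_eq_iff z(1) assms(1,2) by blast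
  qed
  moreover have "x \<in> path_from x y \<inter> path_from y x" "y \<in> path_from x y \<inter> path_from y x"
    using assms pos_bounds[OF assms(1)] pos_bounds[OF assms(2)] by (auto simp: path_from_def travel_def)
  ultimately show ?thesis unfolding path_from_def by blast
qed

lemma path_from_self: "x \<in> points \<Longrightarrow> path_from x x = {x}"
proof -
  assume x: "x \<in> points"
  have "travel x z \<le> travel x x \<longleftrightarrow> z = x" if z: "z \<in> points" for z
    using pos_bounds[OF z] pos_bounds[OF x] pos_eq_iff[OF z x] by (auto simp: travel_def)
  then show ?thesis using x by (auto simp: path_from_def)
qed

end

end

theory Submission
  imports Defs
begin

text \<open>
  Call the number of sets \<open>D v\<close> containing \<open>x\<close> the depth of \<open>x\<close>. Cut the circle open at a point \<open>x\<close> and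
  keep only the sets \<open>D v\<close> that miss \<open>x\<close>. For two of them, the path between their vertices that lies in
  their union cannot be the one through \<open>x\<close>, so it is the segment between the vertices in the
  opened circle. The sets missing \<open>x\<close> therefore form a KKM cover of a line, and on a line all sets
  of a KKM cover have a common point \<open>y\<close> (\<open>interval_KKM\<close>). Every \<open>D v\<close> contains \<open>x\<close> or \<open>y\<close>, so the
  depths of \<open>x\<close> and \<open>y\<close> add up to at least \<open>n\<close> (\<open>common_point_of_missing\<close>).

  If every depth were at most \<open>n div 2\<close>, then for every \<open>x\<close> the depth would also be at least
  \<open>n - n div 2\<close>, hence constant. Finitely many closed sets of constant depth are open
  (\<open>open_if_constant_depth\<close>), so by connectedness each \<open>D v\<close>, which contains \<open>v\<close>, is the whole circle.
  Then the depth is \<open>n\<close>, which exceeds \<open>n div 2\<close>.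

  Both connectedness arguments take place on the real line, the universal cover of the circle.
\<close>

section \<open>Closed sets on the real line\<close>

text \<open>
  A set that misses \<open>y\<close> belongs to a point on the left or on the right of \<open>y\<close>. Both cannot happen for the
  same \<open>y\<close>, since \<open>y\<close> would lie on a segment covered by the two missing sets. Without a common point, the
  places where a set is missed from either side would thus be two disjoint open sets separating the
  segment spanned by the points: at its left end only sets of points to the right can be missed, and
  conversely.
\<close>

lemma interval_KKM:
  fixes p :: "'a \<Rightarrow> real" and C :: "'a \<Rightarrow> real set"
  assumes fin: "finite I"
    and closed: "\<And>i. i \<in> I \<Longrightarrow> closed (C i)"
    and self: "\<And>i. i \<in> I \<Longrightarrow> p i \<in> C i"
    and cover: "\<And>i j. i \<in> I \<Longrightarrow> j \<in> I \<Longrightarrow> p i \<le> p j \<Longrightarrow> {p i..p j} \<subseteq> C i \<union> C j"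
  shows "\<exists>y. \<forall>i\<in>I. y \<in> C i"
proof (rule ccontr)
  assume none: "\<nexists>y. \<forall>i\<in>I. y \<in> C i"
  define A where "A = (\<Union>i\<in>I. {p i<..} \<inter> - C i)"
  define B where "B = (\<Union>i\<in>I. {..<p i} \<inter> - C i)"
  have ne: "p ` I \<noteq> {}" using none by auto
  define a where "a = Min (p ` I)"
  define b where "b = Max (p ` I)"
  have ab: "a \<le> p i" "p i \<le> b" if "i \<in> I" for i
    using that fin by (auto simp: a_def b_def)
  have "a \<le> b" using ne ab by force
  have open_AB: "open A" "open B"
    unfolding A_def B_def using closed by (auto intro!: open_UN open_Int)
  have missed: "y \<in> A \<union> B" for y
  proof -
    obtain i where i: "i \<in> I" "y \<notin> C i" using none by blast
    then have "y \<noteq> p i" using self by auto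
    then show ?thesis using i by (force simp: A_def B_def)
  qed
  have disjoint: "A \<inter> B = {}"
  proof -
    have False if "i \<in> I" "j \<in> I" "p i < y" "y < p j" "y \<notin> C i" "y \<notin> C j" for i j y
    proof -
      have "y \<in> {p i..p j}" "p i \<le> p j" using that by auto
      then show False using cover[of i j] that by blast
    qed
    then show ?thesis by (auto simp: A_def B_def)
  qed
  have "a \<notin> A" "b \<notin> B" using ab by (force simp: A_def B_def)+
  then have "a \<in> B \<inter> {a..b}" "b \<in> A \<inter> {a..b}" using missed \<open>a \<le> b\<close> by auto
  then show False
    using connectedD[OF connected_Icc open_AB, of a b] disjoint missed by blast
qed

text \<open>
  Near \<open>x\<close>, a point can only leave sets containing \<open>x\<close>, never enter a closed set that misses \<open>x\<close>. As the
  number of sets stays the same, it leaves none either.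
\<close>

lemma open_if_constant_depth:
  fixes C :: "'a \<Rightarrow> 'b::topological_space set"
  assumes fin: "finite I"
    and closed: "\<And>i. i \<in> I \<Longrightarrow> closed (C i)"
    and const: "\<And>x. card {i\<in>I. x \<in> C i} = k"
    and i: "i \<in> I"
  shows "open (C i)"
proof (subst open_subopen, intro ballI)
  fix x assume x: "x \<in> C i"
  define N where "N = (\<Inter>j\<in>{j\<in>I. x \<notin> C j}. - C j)"
  have "open N"
    unfolding N_def using fin closed by (intro open_INT) auto
  moreover have "x \<in> N" by (auto simp: N_def)
  moreover have "y \<in> C i" if y: "y \<in> N" for y
  proof -
    have "{j\<in>I. y \<in> C j} \<subseteq> {j\<in>I. x \<in> C j}" using y by (auto simp: N_def)
    then have "{j\<in>I. y \<in> C j} = {j\<in>I. x \<in> C j}"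
      using fin const by (intro card_subset_eq) auto
    then show ?thesis using x i by blast
  qed
  ultimately show "\<exists>T. open T \<and> x \<in> T \<and> T \<subseteq> C i" by blast
qed

section \<open>The universal cover of a metric cycle\<close>

context metric_cycle
begin

text \<open>
  The covering map that wraps the real line around the circle, starting with vertex \<open>0\<close> at \<open>0\<close>; the
  argument of \<open>inv_into\<close> is \<open>s\<close> modulo \<open>total_length\<close>.
\<close>

definition unroll :: "real \<Rightarrow> (nat \<times> real) set" where
  "unroll s = inv_into points pos (total_length * frac (s / total_length))"

lemma total_length_pos: "0 < total_length"
  unfolding total_length_def using n_pos L_pos by (intro sum_pos) (auto simp: lessThan_empty_iff)

lemma
  shows unroll_in_points: "unroll s \<in> points"
    and pos_unroll: "pos (unroll s) = total_length * frac (s / total_length)"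
proof -
  have "total_length * frac (s / total_length) \<in> pos ` points"
    using total_length_pos frac_lt_1[of "s / total_length"] by (simp add: pos_image)
  then show "unroll s \<in> points" "pos (unroll s) = total_length * frac (s / total_length)"
    unfolding unroll_def by (auto intro: inv_into_into f_inv_into_f)
qed

lemma unroll_add_multiple: "unroll (s + of_int k * total_length) = unroll s"
  using total_length_pos by (simp add: unroll_def add_divide_distrib frac_def)

lemma unroll_add_total_length: "unroll (s + total_length) = unroll s"
  using unroll_add_multiple[of s 1] by simp

lemma pos_unroll_fundamental: "0 \<le> s \<Longrightarrow> s < total_length \<Longrightarrow> pos (unroll s) = s"
  using total_length_pos by (simp add: pos_unroll frac_eq[THEN iffD2])

lemma unroll_pos: "x \<in> points \<Longrightarrow> unroll (pos x) = x"
  using pos_inject unroll_in_points pos_unroll_fundamental pos_bounds by blast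

text \<open>
  Shifting \<open>p\<close> into \<open>[0, total_length)\<close> turns the case distinction in \<open>travel\<close> into the question whether
  the shifted \<open>r\<close> has passed vertex \<open>0\<close>. All facts about paths and distances reduce to this formula.
\<close>

lemma travel_unroll:
  assumes "p \<le> r" "r < p + total_length"
  shows "travel (unroll p) (unroll r) = r - p"
proof -
  define k where "k = \<lfloor>p / total_length\<rfloor>"
  define p' where "p' = p + of_int (- k) * total_length"
  define r' where "r' = r + of_int (- k) * total_length"
  have "of_int k \<le> p / total_length" "p / total_length < of_int k + 1"
    unfolding k_def by linarith+
  then have p': "0 \<le> p'" "p' < total_length"
    using total_length_pos by (auto simp: p'_def field_simps)
  have r': "p' \<le> r'" "r' < p' + total_length" using assms by (auto simp: p'_def r'_def)
  have *: "unroll p = unroll p'" "unroll r = unroll r'"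
    unfolding p'_def r'_def unroll_add_multiple by simp_all
  have pp: "pos (unroll p') = p'" using pos_unroll_fundamental p' by simp
  have diff: "r' - p' = r - p" by (simp add: p'_def r'_def)
  show ?thesis
  proof (cases "r' < total_length")
    case True
    then have "pos (unroll r') = r'" using pos_unroll_fundamental p' r' by simp
    then show ?thesis using * pp r' diff by (simp add: travel_def)
  next
    case False
    then have "pos (unroll (r' - total_length)) = r' - total_length"
      using pos_unroll_fundamental p' r' by simp
    then have "pos (unroll r') = r' - total_length"
      using unroll_add_total_length[of "r' - total_length"] by simp
    then show ?thesis using * pp r' diff by (simp add: travel_def)
  qed
qed

lemma ex_lift:
  assumes "x \<in> points"
  shows "\<exists>p. s \<le> p \<and> p < s + total_length \<and> unroll p = x"
proof -
  define k where "k = \<lceil>(s - pos x) / total_length\<rceil>"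
  have "(s - pos x) / total_length \<le> of_int k" "of_int k < (s - pos x) / total_length + 1"
    unfolding k_def by linarith+
  then have "s \<le> pos x + of_int k * total_length"
    "pos x + of_int k * total_length < s + total_length"
    using total_length_pos by (auto simp: field_simps)
  then show ?thesis using unroll_pos[OF assms] unroll_add_multiple by metis
qed

lemma unroll_Icc_subset_path_from:
  assumes "p \<le> q" "q < p + total_length"
  shows "unroll ` {p..q} \<subseteq> path_from (unroll p) (unroll q)"
  using assms unroll_in_points by (auto simp: path_from_def travel_unroll)

lemma continuous_unroll: "continuous_map euclidean mtopology unroll"
  unfolding continuous_map_to_metric
proof (intro ballI allI impI)
  fix s \<epsilon> :: real assume \<epsilon>: "0 < \<epsilon>"
  \<comment> \<open>Below \<open>total_length\<close>, a step on the line is one of the two paths on the circle.\<close>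
  define \<delta> where "\<delta> = min \<epsilon> total_length"
  have "cdist (unroll s) (unroll t) < \<epsilon>" if "t \<in> ball s \<delta>" for t
  proof (cases "s \<le> t")
    case True
    then have "travel (unroll s) (unroll t) = t - s"
      using that by (intro travel_unroll) (auto simp: \<delta>_def dist_real_def)
    then show ?thesis using that True by (auto simp: cdist_def unroll_in_points \<delta>_def dist_real_def)
  next
    case False
    then have "travel (unroll t) (unroll s) = s - t"
      using that by (intro travel_unroll) (auto simp: \<delta>_def dist_real_def)
    then show ?thesis using that False by (auto simp: cdist_def unroll_in_points \<delta>_def dist_real_def)
  qed
  then show "\<exists>U. openin euclidean U \<and> s \<in> U \<and> (\<forall>y\<in>U. unroll y \<in> mball (unroll s) \<epsilon>)"
    using \<epsilon> total_length_pos unroll_in_points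
    by (intro exI[of _ "ball s \<delta>"]) (auto simp: \<delta>_def)
qed

lemma closed_unroll_vimage: "closedin mtopology S \<Longrightarrow> closed (unroll -` S)"
  using closedin_continuous_map_preimage[OF continuous_unroll, of S] by (simp add: vimage_def)

section \<open>Depths of a KKM cover\<close>

text \<open>
  Lift every vertex whose set misses \<open>unroll s\<close> into the window \<open>[s, s + total_length)\<close>. Of the two paths
  between two such vertices, the one that leaves the window lifts to a segment around
  \<open>s + total_length\<close>, a lift of the missed point; so the cover condition holds for the segment
  inside the window.
\<close>

lemma common_point_of_missing:
  assumes D: "kkm_cover D"
  shows "\<exists>t. \<forall>v<n. unroll s \<notin> D v \<longrightarrow> unroll t \<in> D v"
proof -
  define I where "I = {v. v < n \<and> unroll s \<notin> D v}"
  have "\<forall>v. \<exists>p. v < n \<longrightarrow> s \<le> p \<and> p < s + total_length \<and> unroll p = vertex v"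
    using ex_lift vertex_in_points by blast
  then obtain p where
    p: "\<And>v. v < n \<Longrightarrow> s \<le> p v \<and> p v < s + total_length \<and> unroll (p v) = vertex v"
    by metis
  have "\<exists>t. \<forall>v\<in>I. t \<in> unroll -` D v"
  proof (rule interval_KKM[where p = p])
    show "finite I" by (simp add: I_def)
    show "closed (unroll -` D v)" if "v \<in> I" for v
      using D that by (auto simp: I_def kkm_cover_def intro: closed_unroll_vimage)
    show "p v \<in> unroll -` D v" if "v \<in> I" for v
      using D that p by (auto simp: I_def kkm_cover_def)
    show "{p v..p w} \<subseteq> unroll -` D v \<union> unroll -` D w"
      if v: "v \<in> I" and w: "w \<in> I" and le: "p v \<le> p w" for v w
    proof -
      have vw: "v < n" "w < n" "unroll s \<notin> D v \<union> D w" using v w by (auto simp: I_def)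
      note pv = p[OF vw(1)] and pw = p[OF vw(2)]
      have inner: "unroll ` {p v..p w} \<subseteq> path_from (vertex v) (vertex w)"
        using unroll_Icc_subset_path_from[OF le] pv pw by auto
      show ?thesis
      proof (cases "p v = p w")
        case True
        then show ?thesis using D vw pv by (auto simp: kkm_cover_def)
      next
        case False
        then have "unroll ` {p w..p v + total_length} \<subseteq> path_from (vertex w) (vertex v)"
          using unroll_Icc_subset_path_from[of "p w" "p v + total_length"] le pv pw
          by (auto simp: unroll_add_total_length)
        moreover have "s + total_length \<in> {p w..p v + total_length}" using pv pw by auto
        ultimately have "unroll s \<in> path_from (vertex w) (vertex v)"
          using unroll_add_total_length by (metis image_subset_iff)
        then have "path_from (vertex v) (vertex w) \<subseteq> D v \<union> D w"
          using D vw unfolding kkm_cover_def by blast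
        then show ?thesis using inner by auto
      qed
    qed
  qed
  then show ?thesis by (auto simp: I_def)
qed

theorem kkm_cover_depth:
  assumes D: "kkm_cover D"
  shows "\<exists>x\<in>points. n div 2 + 1 \<le> card {v. v < n \<and> x \<in> D v}"
proof (rule ccontr)
  define depth where "depth s = card {v\<in>{..<n}. s \<in> unroll -` D v}" for s
  assume "\<not> ?thesis"
  then have "card {v. v < n \<and> unroll s \<in> D v} < n div 2 + 1" for s
    using unroll_in_points by (metis not_le)
  then have upper: "depth s \<le> n div 2" for s
    by (simp add: depth_def less_Suc_eq_le)
  have const: "depth s = n div 2" for s
  proof -
    obtain t where "\<forall>v<n. unroll s \<notin> D v \<longrightarrow> unroll t \<in> D v"
      using common_point_of_missing[OF D] by blast
    then have "{..<n} = {v\<in>{..<n}. s \<in> unroll -` D v} \<union> {v\<in>{..<n}. t \<in> unroll -` D v}"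
      by auto
    then have "n \<le> depth s + depth t"
      unfolding depth_def using card_Un_le by (metis card_lessThan)
    \<comment> \<open>The depth of \<open>t\<close> is at most \<open>n div 2\<close>, and \<open>n - n div 2\<close> is at least \<open>n div 2\<close>.\<close>
    then show ?thesis using upper[of s] upper[of t] by linarith
  qed
  have whole: "unroll -` D v = UNIV" if v: "v < n" for v
  proof -
    have closed: "closed (unroll -` D w)" if "w \<in> {..<n}" for w
      using D that by (auto simp: kkm_cover_def intro: closed_unroll_vimage)
    have "open (unroll -` D v)"
      using open_if_constant_depth[of "{..<n}" "\<lambda>w. unroll -` D w", OF _ closed const[unfolded depth_def]] v
      by auto
    moreover have "pos (vertex v) \<in> unroll -` D v"
      using D v unroll_pos vertex_in_points by (simp add: kkm_cover_def)
    ultimately show ?thesis using closed v clopen[of "unroll -` D v"] by auto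
  qed
  then have "{v\<in>{..<n}. 0 \<in> unroll -` D v} = {..<n}" by auto
  then have "depth 0 = n" by (simp add: depth_def)
  then show False using const[of 0] n_pos by simp
qed

end

theorem theorem14:
  fixes n :: nat and L :: "nat \<Rightarrow> real" and D :: "nat \<Rightarrow> (nat \<times> real) set set"
  assumes "metric_cycle n L"
    and "metric_cycle.kkm_cover n L D"
  shows "\<exists>x \<in> metric_cycle.points n L. card {v. v < n \<and> x \<in> D v} \<ge> n div 2 + 1"
  using metric_cycle.kkm_cover_depth[OF assms] .

end
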